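(* For every real $\rho\ge 0$ with $\zeta(1/2+i\rho)\neq 0$ there is an integer $k$ (depending on $\rho$) such that $$\arg\zeta(1/2+i\rho)=-\frac12\int_0^\rho \mathrm{Re}\,\psi(1/2+it)\,dt+\frac{\rho}{2}\ln(2\pi)-\frac{9\pi}{8}+\frac12\arctan(e^{\pi\rho})+k\pi,$$ and there is an integer $k'$ (depending on $\rho$) such that $$\arg\zeta(1/2+i\rho)=\frac{\rho}{2}\ln(2\pi)-\frac12\arg\Gamma(1/2+i\rho)-\frac{9\pi}{8}+\frac12\arctan(e^{\pi\rho})-k'\pi.$$ Moreover, in the first formula $k$ is constant on any interval of $\rho$ on which $\arg\zeta(1/2+i\rho)$ is continuous.
   Context: $\zeta$ is the Riemann zeta function, $\Gamma$ the gamma function, $\psi=\Gamma'/\Gamma$ the digamma function; $\arg$ denotes the principal argument in $(-\pi,\pi]$. *)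

theory Defs
  imports "HOL-Complex_Analysis.Complex_Analysis"
begin

(* The value at the pole s = 1 is unspecified; on the connected domain - {1} the
   identity theorem makes the choice unique. *)
definition zeta :: "complex \<Rightarrow> complex" where
  "zeta = (SOME f. f holomorphic_on (- {1}) \<and>
             (\<forall>s. Re s > 1 \<longrightarrow> f s = (\<Sum>n. 1 / of_nat (Suc n) powr s)))"

end

theory Submission
  imports Defs
begin

text \<open>
  The functional equation gives
  \<open>cnj (\<zeta> s) = \<zeta> (1 - s) = 2 (2\<pi>) powr (-s) cos (\<pi>s/2) \<Gamma>(s) \<zeta>(s)\<close> for \<open>s = 1/2 + \<i>\<rho>\<close>. Comparing
  arguments determines \<open>2 arg \<zeta>(s)\<close> modulo \<open>2\<pi>\<close>; the argument of \<open>cos (\<pi>s/2)\<close> is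
  \<open>\<pi>/4 - arctan (exp (\<pi>\<rho>))\<close>, and \<open>\<integral> Re \<psi>\<close> is the imaginary part of \<open>ln \<Gamma>\<close>.

  For the functional equation, put \<open>gap \<phi> = \<integral> (\<phi>(x) - \<phi>(\<lceil>x\<rceil>)) dx\<close> over \<open>x > 0\<close>. For real
  \<open>0 < s < 1\<close> one has \<open>gap (x powr (-s)) = - \<zeta>(s)\<close>. Both \<open>exp (-xt)\<close> and
  \<open>2t / (t\<^sup>2 + 4\<pi>\<^sup>2x\<^sup>2)\<close> have gap \<open>1/t - 1/(exp t - 1)\<close> in \<open>x\<close>, the second by the partial fraction
  expansion of the cotangent. Taking Mellin transforms in \<open>t\<close> of both (Tonelli: every integrand is
  nonnegative) yields \<open>\<Gamma>(s) \<zeta>(s)\<close> and a multiple of \<open>\<zeta>(1 - s)\<close>. The identity theorem extends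
  the equation to the strip \<open>0 < Re s < 1\<close>, and it then also provides the continuation of the
  Dirichlet series to the half-plane \<open>Re s < 1\<close>.
\<close>

subsection \<open>The half-plane of positive real part\<close>

definition zeta_term :: "nat \<Rightarrow> complex \<Rightarrow> complex" where
  "zeta_term n s = (s - 1) * of_nat (Suc n) powr (-s) - of_nat (Suc n) powr (1 - s)
     + of_nat (Suc (Suc n)) powr (1 - s)"

text \<open>
  \<open>zeta_reg s\<close> is \<open>(s - 1) \<zeta>(s)\<close> for \<open>Re s > 0\<close>: each term is a first-order Taylor remainder of
  \<open>x powr (1 - s)\<close>, hence of size \<open>n powr (- Re s - 1)\<close>.
\<close>
definition zeta_reg :: "complex \<Rightarrow> complex" where
  "zeta_reg s = 1 + (\<Sum>n. zeta_term n s)"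

text \<open>\<open>zeta_term n s\<close> is the remainder at \<open>m + 1\<close> of
  \<open>z powr (1 - s)\<close> after its linear Taylor polynomial at \<open>m = n + 1\<close>. The
  second derivative is largest in norm at the left end of the segment. \<open>complex_Taylor\<close>
  divides by \<open>fact 1\<close>, hence no factor 1/2.\<close>

lemma norm_zeta_term_le:
  assumes "Re s > 0"
  shows "norm (zeta_term n s) \<le> norm (1 - s) * norm s * real (Suc n) powr (- Re s - 1)"
proof -
  define m where "m = real (Suc n)"
  have m: "m > 0" by (simp add: m_def)
  define f :: "nat \<Rightarrow> complex \<Rightarrow> complex" where "f = (\<lambda>i z. if i = 0 then z powr (1 - s) else if i = 1 then (1 - s) * z powr (-s)
      else (1 - s) * (-s) * z powr (-s - 1))"
  let ?S = "closed_segment (of_real m) (of_real (m + 1)) :: complex set"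
  have S: "\<exists>x\<ge>m. z = of_real x" if "z \<in> ?S" for z
    using that unfolding closed_segment_of_real by (auto simp: closed_segment_eq_real_ivl)
  have "norm (f 0 (of_real (m + 1)) - (\<Sum>i\<le>1. f i (of_real m) * (of_real (m+1) - of_real m) ^ i / fact i))
     \<le> (norm (1 - s) * norm s * m powr (- Re s - 1)) * norm (of_real (m+1) - of_real m :: complex) ^ Suc 1 / fact 1"
  proof (rule complex_Taylor)
    fix i z assume z: "z \<in> ?S" and i: "i \<le> (1::nat)"
    obtain x where x: "x \<ge> m" "z = of_real x" using S[OF z] by blast
    have "i = 0 \<or> i = 1" using i by auto
    then show "(f i has_field_derivative f (Suc i) z) (at z within ?S)"
    proof
      assume [simp]: "i = 0"
      show ?thesis unfolding f_def using x m
        by (auto intro!: derivative_eq_intros simp: complex_nonpos_Reals_iff)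
    next
      assume [simp]: "i = 1"
      show ?thesis unfolding f_def using x m
        by (auto intro!: derivative_eq_intros simp: complex_nonpos_Reals_iff)
    qed
  next
    fix z assume z: "z \<in> ?S"
    obtain x where x: "x \<ge> m" "z = of_real x" using S[OF z] by blast
    have "norm (f (Suc 1) z) = norm (1 - s) * norm s * x powr (- Re s - 1)"
      using x m by (simp add: f_def norm_mult norm_powr_real_powr)
    also have "\<dots> \<le> norm (1 - s) * norm s * m powr (- Re s - 1)"
      using x m assms by (intro mult_left_mono powr_mono2') auto
    finally show "norm (f (Suc 1) z) \<le> norm (1 - s) * norm s * m powr (- Re s - 1)" .
  qed auto
  moreover have "f 0 (of_real (m + 1)) - (\<Sum>i\<le>1. f i (of_real m) * (of_real (m+1) - of_real m) ^ i / fact i)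
      = zeta_term n s"
    by (simp add: f_def zeta_term_def m_def algebra_simps)
  ultimately show ?thesis by (simp add: m_def)
qed

lemma holomorphic_zeta_term [holomorphic_intros]: "zeta_term n holomorphic_on A"
  unfolding zeta_term_def by (intro holomorphic_intros) (auto simp del: of_nat_Suc)

lemma summable_real_powr: "c < -1 \<Longrightarrow> summable (\<lambda>n. real (Suc n) powr c)"
  using summable_real_powr_iff[of c] by (subst summable_Suc_iff) simp

lemma summable_zeta_term:
  assumes "Re s > 0" shows "summable (\<lambda>n. zeta_term n s)"
proof (rule summable_comparison_test')
  show "summable (\<lambda>n. norm (1 - s) * norm s * real (Suc n) powr (- Re s - 1))"
    using assms by (intro summable_mult summable_real_powr) auto
qed (use norm_zeta_term_le[OF assms] in auto)

lemma holomorphic_zeta_reg: "zeta_reg holomorphic_on {s. Re s > 0}"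
proof -
  have "(\<lambda>s. \<Sum>n. zeta_term n s) holomorphic_on {s. Re s > 0}"
  proof (rule holomorphic_uniform_sequence)
    show "open {s. Re s > 0}" by (rule open_halfspace_Re_gt)
    show "(\<lambda>s. \<Sum>i<n. zeta_term i s) holomorphic_on {s. Re s > 0}" for n
      by (intro holomorphic_intros)
    fix s :: complex assume "s \<in> {s. Re s > 0}"
    then have s: "Re s > 0" by simp
    \<comment> \<open>With the radius equal to half the distance to the imaginary axis,
      \<open>Re z \<ge> d\<close> holds on the whole ball, so one convergent majorant with exponent
      \<open>- d - 1\<close> serves all its points.\<close>
    define d where "d = Re s / 2"
    have d: "d > 0" using s by (simp add: d_def)
    have R: "Re z \<ge> d" if "z \<in> cball s d" for z
    proof -
      have "\<bar>Re (s - z)\<bar> \<le> norm (s - z)" by (rule abs_Re_le_cmod)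
      then show ?thesis using that by (auto simp: d_def dist_norm)
    qed
    define M where "M = norm s + d"
    have M: "norm z \<le> M" "norm (1 - z) \<le> 1 + M" if "z \<in> cball s d" for z
    proof -
      have "norm z \<le> norm s + norm (z - s)" by (metis add.commute diff_add_cancel norm_triangle_ineq)
      then show "norm z \<le> M" using that by (simp add: M_def dist_norm norm_minus_commute)
      then show "norm (1 - z) \<le> 1 + M" using norm_triangle_ineq4[of 1 z] by simp
    qed
    have "uniform_limit (cball s d) (\<lambda>n z. \<Sum>i<n. zeta_term i z) (\<lambda>z. \<Sum>n. zeta_term n z) sequentially"
    proof (rule Weierstrass_m_test)
      show "summable (\<lambda>n. (1 + M) * M * real (Suc n) powr (- d - 1))"
        using d by (intro summable_mult summable_real_powr) auto
      fix n z assume z: "z \<in> cball s d"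
      have "norm (zeta_term n z) \<le> norm (1 - z) * norm z * real (Suc n) powr (- Re z - 1)"
        using R[OF z] d by (intro norm_zeta_term_le) auto
      also have "\<dots> \<le> (1 + M) * M * real (Suc n) powr (- d - 1)"
        using M[OF z] R[OF z] norm_ge_zero[of z] d
        by (intro mult_mono powr_mono) (auto simp del: of_nat_Suc norm_ge_zero)
      finally show "norm (zeta_term n z) \<le> (1 + M) * M * real (Suc n) powr (- d - 1)" .
    qed
    moreover have "cball s d \<subseteq> {s. Re s > 0}" using R d by force
    ultimately show "\<exists>d>0. cball s d \<subseteq> {s. Re s > 0} \<and>
       uniform_limit (cball s d) (\<lambda>n s. \<Sum>i<n. zeta_term i s) (\<lambda>z. \<Sum>n. zeta_term n z) sequentially"
      using d by blast
  qed
  then show ?thesis unfolding zeta_reg_def by (intro holomorphic_intros)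
qed

text \<open>The parts in \<open>powr (1 - s)\<close> telescope, and the leading \<open>1\<close> of
  \<open>zeta_reg\<close> cancels their lower boundary value.\<close>

lemma sum_zeta_term:
  "1 + (\<Sum>n<N. zeta_term n s) = (s - 1) * (\<Sum>n<N. of_nat (Suc n) powr (-s)) + of_nat (Suc N) powr (1 - s)"
  by (induction N) (auto simp: zeta_term_def algebra_simps)

lemma zeta_reg_LIMSEQ:
  assumes "Re s > 0"
  shows "(\<lambda>N. (s - 1) * (\<Sum>n<N. of_nat (Suc n) powr (-s)) + of_nat (Suc N) powr (1 - s)) \<longlonglongrightarrow> zeta_reg s"
  unfolding sum_zeta_term[symmetric] zeta_reg_def
  by (intro tendsto_intros summable_LIMSEQ summable_zeta_term assms)

text \<open>For \<open>Re s > 1\<close> the boundary term \<open>of_nat (Suc N) powr (1 - s)\<close>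
  tends to 0, so only the Dirichlet partial sums survive in \<open>zeta_reg_LIMSEQ\<close>.\<close>

lemma zeta_reg_Dirichlet_series:
  assumes "Re s > 1"
  shows "zeta_reg s / (s - 1) = (\<Sum>n. 1 / of_nat (Suc n) powr s)"
proof -
  have "s \<noteq> 1" using assms by auto
  have "(\<lambda>n. norm (of_nat (Suc n) powr (1 - s) :: complex)) \<longlonglongrightarrow> 0"
  proof -
    have "(\<lambda>n. real (Suc n) powr (1 - Re s)) \<longlonglongrightarrow> 0"
      using assms by (intro tendsto_neg_powr filterlim_compose[OF filterlim_real_sequentially] filterlim_Suc) auto
    then show ?thesis using assms by (simp add: norm_powr_real_powr del: of_nat_Suc)
  qed
  then have "(\<lambda>n. of_nat (Suc n) powr (1 - s) :: complex) \<longlonglongrightarrow> 0"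
    by (rule tendsto_norm_zero_cancel)
  from tendsto_diff[OF zeta_reg_LIMSEQ[of s] this] assms
  have "(\<lambda>N. (s - 1) * (\<Sum>n<N. of_nat (Suc n) powr (-s))) \<longlonglongrightarrow> zeta_reg s" by simp
  then have "(\<lambda>N. (s - 1) * (\<Sum>n<N. of_nat (Suc n) powr (-s)) / (s - 1)) \<longlonglongrightarrow> zeta_reg s / (s - 1)"
    using assms by (intro tendsto_intros) auto
  then have "(\<lambda>n. 1 / of_nat (Suc n) powr s) sums (zeta_reg s / (s - 1))"
    using \<open>s \<noteq> 1\<close> unfolding sums_def powr_minus by (auto simp: inverse_eq_divide simp del: of_nat_Suc)
  then show ?thesis by (simp add: sums_iff)
qed

lemma cnj_zeta_reg: 
  assumes "Re s > 0"
  shows "cnj (zeta_reg s) = zeta_reg (cnj s)"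
proof -
  have "cnj (zeta_term n s) = zeta_term n (cnj s)" for n
    by (simp add: zeta_term_def cnj_powr del: of_nat_Suc)
  moreover have "(\<lambda>n. cnj (zeta_term n s)) sums cnj (\<Sum>n. zeta_term n s)"
    using summable_sums[OF summable_zeta_term[OF assms]] by (simp only: sums_cnj)
  ultimately show ?thesis by (simp add: zeta_reg_def sums_iff)
qed

subsection \<open>Gaps of decreasing functions and their Mellin transforms\<close>

text \<open>Intended for decreasing \<phi>, where each integrand is nonnegative and the truncation
  by \<open>ennreal\<close> loses nothing. The value can be finite although integral and sum of
  \<phi> both diverge, as for \<open>x powr (-s)\<close> with \<open>0 < s < 1\<close>.\<close>

definition gap :: "(real \<Rightarrow> real) \<Rightarrow> ennreal" where
  "gap \<phi> = (\<Sum>n. \<integral>\<^sup>+x\<in>{real n<..<real (Suc n)}. ennreal (\<phi> x - \<phi> (real (Suc n))) \<partial>lborel)"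

lemma gap_cong: "(\<And>x. x > 0 \<Longrightarrow> \<phi> x = \<psi> x) \<Longrightarrow> gap \<phi> = gap \<psi>"
  unfolding gap_def by (intro suminf_cong nn_integral_cong) (auto simp: indicator_def)

lemma gap_cmult:
  assumes [measurable]: "\<phi> \<in> borel_measurable borel" and c: "c \<ge> 0"
  shows "gap (\<lambda>x. c * \<phi> x) = ennreal c * gap \<phi>"
proof -
  have "(\<integral>\<^sup>+x\<in>{real n<..<real (Suc n)}. ennreal (c * \<phi> x - c * \<phi> (real (Suc n))) \<partial>lborel)
     = ennreal c * (\<integral>\<^sup>+x\<in>{real n<..<real (Suc n)}. ennreal (\<phi> x - \<phi> (real (Suc n))) \<partial>lborel)" for n
    by (subst nn_integral_cmult[symmetric])
      (auto simp: right_diff_distrib[symmetric] ennreal_mult' c mult.assoc)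
  then show ?thesis by (simp add: gap_def)
qed

text \<open>With an antiderivative \<open>P\<close>, cell \<open>n\<close> contributes
  \<open>P (n + 1) - P n - \<phi> (n + 1)\<close>, and the \<open>P\<close> values telescope. At 0
  only continuity of \<open>P\<close> is asked, since \<phi> may blow up there.\<close>

lemma gap_eqI:
  fixes \<phi> P :: "real \<Rightarrow> real"
  assumes [measurable]: "\<phi> \<in> borel_measurable borel"
    and anti: "\<And>x y. 0 < x \<Longrightarrow> x \<le> y \<Longrightarrow> \<phi> y \<le> \<phi> x"
    and P: "\<And>x. x > 0 \<Longrightarrow> (P has_real_derivative \<phi> x) (at x)" "continuous_on {0..} P"
    and lim: "(\<lambda>N. P (real N) - P 0 - (\<Sum>n<N. \<phi> (real (Suc n)))) \<longlonglongrightarrow> L"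
  shows "gap \<phi> = ennreal L" "L \<ge> 0"
proof -
  define a where "a n = P (real (Suc n)) - P (real n) - \<phi> (real (Suc n))" for n
  have I: "((\<lambda>x. \<phi> x - \<phi> (real (Suc n))) has_integral a n) {real n<..<real (Suc n)}" for n
  proof -
    have "(\<phi> has_integral (P (real (Suc n)) - P (real n))) {real n..real (Suc n)}"
    proof (rule fundamental_theorem_of_calculus_interior)
      show "continuous_on {real n..real (Suc n)} P"
        by (rule continuous_on_subset[OF P(2)]) auto
      show "(P has_vector_derivative \<phi> x) (at x)" if "x \<in> {real n<..<real (Suc n)}" for x
        using that P(1)[of x] by (auto simp: has_real_derivative_iff_has_vector_derivative)
    qed auto
    from has_integral_diff[OF this has_integral_const_real[of "\<phi> (real (Suc n))"]]
    show ?thesis by (simp add: a_def has_integral_Icc_iff_Ioo)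
  qed
  have nonneg: "\<phi> x - \<phi> (real (Suc n)) \<ge> 0" if "x \<in> {real n<..<real (Suc n)}" for x n
    using that anti[of x "real (Suc n)"] by auto
  have a: "a n \<ge> 0" for n using I nonneg by (rule has_integral_nonneg)
  have J: "(\<integral>\<^sup>+x\<in>{real n<..<real (Suc n)}. ennreal (\<phi> x - \<phi> (real (Suc n))) \<partial>lborel) = ennreal (a n)" for n
  proof -
    have "(\<integral>\<^sup>+x\<in>{real n<..<real (Suc n)}. ennreal (\<phi> x - \<phi> (real (Suc n))) \<partial>lborel)
        = (\<integral>\<^sup>+x. ennreal (if x \<in> {real n<..<real (Suc n)} then \<phi> x - \<phi> (real (Suc n)) else 0) \<partial>lborel)"
      by (intro nn_integral_cong) (auto simp: indicator_def)
    also have "(\<integral>\<^sup>+x. ennreal (if x \<in> {real n<..<real (Suc n)} then \<phi> x - \<phi> (real (Suc n)) else 0) \<partial>lborel) = ennreal (a n)"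
      using nonneg
      by (intro nn_integral_has_integral_lborel has_integral_restrict_UNIV[THEN iffD2] I) auto
    finally show ?thesis .
  qed
  have sum_a: "(\<Sum>n<N. a n) = P (real N) - P 0 - (\<Sum>n<N. \<phi> (real (Suc n)))" for N
    by (induction N) (auto simp: a_def)
  then have "a sums L" using lim by (simp add: sums_def)
  with a show "gap \<phi> = ennreal L" "L \<ge> 0"
    unfolding gap_def J by (auto intro: suminf_ennreal_eq sums_le[OF _ sums_zero])
qed

text \<open>Integration against the weight \<open>g\<close> commutes with \<open>gap\<close>:
  monotonicity of \<open>k\<close> in \<open>x\<close> makes all differences nonnegative, so sum and
  integrals may be interchanged by Tonelli.\<close>

lemma nn_integral_gap:
  fixes g :: "real \<Rightarrow> real" and k :: "real \<Rightarrow> real \<Rightarrow> real"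
  assumes [measurable]: "g \<in> borel_measurable borel" "(\<lambda>(x, t). k x t) \<in> borel_measurable (borel \<Otimes>\<^sub>M borel)"
    and g: "\<And>t. t > 0 \<Longrightarrow> g t \<ge> 0" and k: "\<And>x t. x > 0 \<Longrightarrow> t > 0 \<Longrightarrow> k x t \<ge> 0"
    and anti: "\<And>x y t. 0 < t \<Longrightarrow> 0 < x \<Longrightarrow> x \<le> y \<Longrightarrow> k y t \<le> k x t"
    and \<Phi>: "\<And>x. x > 0 \<Longrightarrow> (\<integral>\<^sup>+t\<in>{0<..}. ennreal (g t * k x t) \<partial>lborel) = ennreal (\<Phi> x)"
            "\<And>x. x > 0 \<Longrightarrow> \<Phi> x \<ge> 0"
  shows "(\<integral>\<^sup>+t\<in>{0<..}. (ennreal (g t) * gap (\<lambda>x. k x t)) \<partial>lborel) = gap \<Phi>"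
proof -
  have km[measurable]: "(\<lambda>t. k c t) \<in> borel_measurable borel" for c
    using measurable_compose[OF _ assms(2), of "\<lambda>t. (c, t)" borel] by simp
  have km'[measurable]: "(\<lambda>x. k x t) \<in> borel_measurable borel" for t
    using measurable_compose[OF _ assms(2), of "\<lambda>x. (x, t)" borel] by simp
  define F where "F n x t = ennreal (g t) * ennreal (k x t - k (real (Suc n)) t)
     * indicator {real n<..<real (Suc n)} x * indicator {0<..} t" for n x t
  have Fm[measurable]: "(\<lambda>(x, t). F n x t) \<in> borel_measurable (borel \<Otimes>\<^sub>M borel)" for n
    unfolding F_def by measurable
  have "(\<integral>\<^sup>+t\<in>{0<..}. (ennreal (g t) * gap (\<lambda>x. k x t)) \<partial>lborel)
      = (\<integral>\<^sup>+t. (\<Sum>n. \<integral>\<^sup>+x. F n x t \<partial>lborel) \<partial>lborel)"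
  proof (rule nn_integral_cong)
    fix t
    have "(\<integral>\<^sup>+x. F n x t \<partial>lborel) = ennreal (g t) * indicator {0<..} t *
        (\<integral>\<^sup>+x\<in>{real n<..<real (Suc n)}. ennreal (k x t - k (real (Suc n)) t) \<partial>lborel)" for n
      unfolding F_def by (subst nn_integral_cmult[symmetric]) (auto simp: mult_ac)
    then show "ennreal (g t) * gap (\<lambda>x. k x t) * indicator {0<..} t = (\<Sum>n. \<integral>\<^sup>+x. F n x t \<partial>lborel)"
      unfolding gap_def by (simp only: ennreal_suminf_cmult mult_ac)
  qed
  also have "\<dots> = (\<Sum>n. \<integral>\<^sup>+t. \<integral>\<^sup>+x. F n x t \<partial>lborel \<partial>lborel)"
    by (intro nn_integral_suminf) simp
  also have "\<dots> = (\<Sum>n. \<integral>\<^sup>+x. \<integral>\<^sup>+t. F n x t \<partial>lborel \<partial>lborel)"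
    by (intro suminf_cong lborel_pair.Fubini') simp
  also have "\<dots> = gap \<Phi>"
    unfolding gap_def
  proof (intro suminf_cong nn_integral_cong)
    fix n x
    show "(\<integral>\<^sup>+t. F n x t \<partial>lborel) = ennreal (\<Phi> x - \<Phi> (real (Suc n))) * indicator {real n<..<real (Suc n)} x"
    proof (cases "x \<in> {real n<..<real (Suc n)}")
      case True
      define c where "c = real (Suc n)"
      have x: "x > 0" "x \<le> c" "c > 0" using True by (auto simp: c_def)
      have "(\<integral>\<^sup>+t. F n x t \<partial>lborel) = (\<integral>\<^sup>+t. ennreal (g t * k x t) * indicator {0<..} t
          - ennreal (g t * k c t) * indicator {0<..} t \<partial>lborel)"
        using x True g k anti unfolding F_def c_def[symmetric]
        by (intro nn_integral_cong)
          (auto simp: indicator_def ennreal_mult[symmetric] ennreal_minus right_diff_distrib)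
      \<comment> \<open>The integral of a difference splits because the subtracted integral has the
        finite value \<open>\<Phi> c\<close> and its integrand is pointwise the smaller one.\<close>
      also have "\<dots> = ennreal (\<Phi> x) - ennreal (\<Phi> c)"
        using x g anti \<Phi>(1)[of x] \<Phi>(1)[of c]
        by (subst nn_integral_diff) (auto simp: indicator_def intro!: AE_I2 ennreal_leI mult_left_mono)
      also have "\<dots> = ennreal (\<Phi> x - \<Phi> c)" using \<Phi>(2)[of c] x by (simp add: ennreal_minus)
      finally show ?thesis using True by (simp add: c_def)
    qed (simp add: F_def)
  qed
  finally show ?thesis .
qed

section \<open>Mellin integrals of the two kernels\<close>

lemma nn_integral_powr_exp:
  fixes s x :: real
  assumes s: "s > 0" and x: "x > 0"
  shows "(\<integral>\<^sup>+t\<in>{0<..}. ennreal (t powr (s - 1) * exp (- x * t)) \<partial>lborel) = ennreal (Gamma s * x powr (-s))"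
proof -
  let ?h = "\<lambda>t. ennreal (indicator {0..} t * t powr (s - 1) / exp t)"
  let ?I = "\<integral>\<^sup>+t\<in>{0<..}. ennreal (t powr (s - 1) * exp (- x * t)) \<partial>lborel"
  \<comment> \<open>Substitution of \<open>x * t\<close> for the variable in Euler's integral for
    \<open>Gamma s\<close>.\<close>
  have "ennreal (Gamma s) = ennreal \<bar>x\<bar> * (\<integral>\<^sup>+t. ?h (0 + x * t) \<partial>lborel)"
    using x unfolding Gamma_conv_nn_integral_real[OF s] by (intro nn_integral_real_affine) auto
  also have "(\<integral>\<^sup>+t. ?h (0 + x * t) \<partial>lborel) = (\<integral>\<^sup>+t. ennreal (x powr (s - 1)) * (ennreal (t powr (s - 1) * exp (- x * t)) * indicator {0<..} t) \<partial>lborel)"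
    using x by (intro nn_integral_cong)
      (auto simp: indicator_def powr_mult exp_minus field_simps zero_le_mult_iff simp flip: ennreal_mult)
  also have "\<dots> = ennreal (x powr (s - 1)) * ?I"
    by (intro nn_integral_cmult) auto
  also have "ennreal \<bar>x\<bar> * (ennreal (x powr (s - 1)) * ?I) = ennreal (x powr s) * ?I"
    using x by (simp add: powr_diff mult.assoc[symmetric] flip: ennreal_mult)
  finally have "ennreal (x powr (-s)) * ennreal (Gamma s) = (ennreal (x powr (-s)) * ennreal (x powr s)) * ?I"
    by (simp add: mult.assoc)
  also have "ennreal (x powr (-s)) * ennreal (x powr s) = 1"
    using x by (simp flip: ennreal_mult powr_add)
  finally show ?thesis using s by (simp add: mult.commute flip: ennreal_mult)
qed

text \<open>The substitution \<open>w = t\<^sup>2\<close> in the previous integral, with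
  \<open>s = (p + 1) / 2\<close>. The change of variables is made for absolutely integrable real
  functions, so the nonnegative integral is converted to \<open>has_integral\<close> and
  back.\<close>

lemma nn_integral_powr_gaussian:
  fixes p v :: real
  assumes p: "p > -1" and v: "v > 0"
  shows "(\<integral>\<^sup>+t\<in>{0<..}. ennreal (2 * t powr p * exp (- v * t\<^sup>2)) \<partial>lborel)
     = ennreal (Gamma ((p + 1) / 2) * v powr (-((p + 1) / 2)))"
proof -
  define s where "s = (p + 1) / 2"
  have s: "s > 0" using p by (simp add: s_def)
  define f where "f = (\<lambda>w. w powr (s - 1) * exp (- v * w))"
  have [measurable]: "f \<in> borel_measurable borel" unfolding f_def by measurable
  define b where "b = Gamma s * v powr (-s)"
  have b: "b \<ge> 0" using s by (simp add: b_def)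
  have "((\<lambda>w. if w \<in> {0<..} then f w else 0) has_integral b) UNIV"
  proof (rule nn_integral_has_integral)
    have "(\<integral>\<^sup>+w. ennreal (if w \<in> {0<..} then f w else 0) \<partial>lborel) = (\<integral>\<^sup>+w\<in>{0<..}. ennreal (f w) \<partial>lborel)"
      by (intro nn_integral_cong) (auto simp: indicator_def)
    then show "(\<integral>\<^sup>+w. ennreal (if w \<in> {0<..} then f w else 0) \<partial>lborel) = ennreal b"
      using nn_integral_powr_exp[OF s v] by (simp add: f_def b_def)
  qed (use b in \<open>auto simp: f_def\<close>)
  then have f: "(f has_integral b) {0<..}" by (simp only: has_integral_restrict_UNIV)
  have img: "(\<lambda>t::real. t\<^sup>2) ` {0<..} = {0<..}"
  proof (intro equalityI subsetI)
    fix y :: real assume "y \<in> {0<..}"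
    then show "y \<in> (\<lambda>t. t\<^sup>2) ` {0<..}" by (intro image_eqI[of _ _ "sqrt y"]) auto
  qed auto
  have "f absolutely_integrable_on {0<..} \<and> integral {0<..} f = b"
    using f by (auto simp: has_integral_iff f_def intro!: nonnegative_absolutely_integrable_1)
  then have "(\<lambda>t. \<bar>2 * t\<bar> * f (t\<^sup>2)) absolutely_integrable_on {0<..} \<and>
      integral {0<..} (\<lambda>t. \<bar>2 * t\<bar> * f (t\<^sup>2)) = b"
    by (subst has_absolute_integral_change_of_variables_1'[where g = "\<lambda>t. t\<^sup>2"])
      (auto simp: img inj_on_def intro!: derivative_eq_intros)
  then have "((\<lambda>t. \<bar>2 * t\<bar> * f (t\<^sup>2)) has_integral b) {0<..}"
    by (auto simp: has_integral_iff set_lebesgue_integral_eq_integral)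
  then have "((\<lambda>t. 2 * t powr p * exp (- v * t\<^sup>2)) has_integral b) {0<..}"
  proof (rule has_integral_eq[rotated])
    fix t :: real assume t: "t \<in> {0<..}"
    have "(t\<^sup>2) powr (s - 1) = t powr (2 * (s - 1))"
      using t by (simp add: powr_powr flip: powr_numeral)
    then have "t * (t\<^sup>2) powr (s - 1) = t powr (1 + 2 * (s - 1))"
      using t by (simp only: powr_add) simp
    also have "1 + 2 * (s - 1) = p" by (simp add: s_def field_simps)
    finally show "\<bar>2 * t\<bar> * f (t\<^sup>2) = 2 * t powr p * exp (- v * t\<^sup>2)" using t by (simp add: f_def)
  qed
  then have "((\<lambda>t. if t \<in> {0<..} then 2 * t powr p * exp (- v * t\<^sup>2) else 0) has_integral b) UNIV"
    by (simp only: has_integral_restrict_UNIV)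
  then have "(\<integral>\<^sup>+t. ennreal (if t \<in> {0<..} then 2 * t powr p * exp (- v * t\<^sup>2) else 0) \<partial>lborel) = ennreal b"
    by (intro nn_integral_has_integral_lborel) auto
  also have "(\<integral>\<^sup>+t. ennreal (if t \<in> {0<..} then 2 * t powr p * exp (- v * t\<^sup>2) else 0) \<partial>lborel)
     = (\<integral>\<^sup>+t\<in>{0<..}. ennreal (2 * t powr p * exp (- v * t\<^sup>2)) \<partial>lborel)"
    by (intro nn_integral_cong) (auto simp: indicator_def)
  finally show ?thesis by (simp add: b_def s_def)
qed

text \<open>Write \<open>1 / (t\<^sup>2 + a\<^sup>2)\<close> as the integral of
  \<open>exp (- v * (t\<^sup>2 + a\<^sup>2))\<close> over \<open>v > 0\<close> and interchange. The
  Gaussian integral in \<open>t\<close> yields the first Gamma factor and a power of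
  \<open>v\<close>; the remaining Euler integral in \<open>v\<close> yields the second.\<close>

lemma nn_integral_powr_over_sum_squares:
  fixes p a :: real
  assumes p: "-1 < p" "p < 1" and a: "a > 0"
  shows "(\<integral>\<^sup>+t\<in>{0<..}. ennreal (2 * t powr p / (t\<^sup>2 + a\<^sup>2)) \<partial>lborel)
     = ennreal (Gamma ((1 + p) / 2) * Gamma ((1 - p) / 2) * a powr (p - 1))"
proof -
  define F where "F t v = ennreal (2 * t powr p * exp (- v * (t\<^sup>2 + a\<^sup>2))) * indicator {0<..} t * indicator {0<..} v" for t v :: real
  have [measurable]: "(\<lambda>(t, v). F t v) \<in> borel_measurable (borel \<Otimes>\<^sub>M borel)"
    unfolding F_def by measurable
  have "(\<integral>\<^sup>+t\<in>{0<..}. ennreal (2 * t powr p / (t\<^sup>2 + a\<^sup>2)) \<partial>lborel) = (\<integral>\<^sup>+t. \<integral>\<^sup>+v. F t v \<partial>lborel \<partial>lborel)"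
  proof (rule nn_integral_cong)
    fix t :: real
    \<comment> \<open>The factor \<open>v powr (1 - 1)\<close>, which is 1 for \<open>v > 0\<close>,
      gives the integrand the shape of \<open>nn_integral_powr_exp\<close> with
      \<open>s = 1\<close>.\<close>
    have "(\<integral>\<^sup>+v. F t v \<partial>lborel) = (\<integral>\<^sup>+v. ennreal (2 * t powr p) * indicator {0<..} t * 
        (ennreal (v powr (1 - 1) * exp (- (t\<^sup>2 + a\<^sup>2) * v)) * indicator {0<..} v) \<partial>lborel)"
      unfolding F_def by (intro nn_integral_cong) (auto simp: indicator_def algebra_simps simp flip: ennreal_mult)
    also have "\<dots> = ennreal (2 * t powr p) * indicator {0<..} t * 
        (\<integral>\<^sup>+v\<in>{0<..}. ennreal (v powr (1 - 1) * exp (- (t\<^sup>2 + a\<^sup>2) * v)) \<partial>lborel)"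
      by (intro nn_integral_cmult) auto
    also have "\<dots> = ennreal (2 * t powr p) * indicator {0<..} t * ennreal (1 / (t\<^sup>2 + a\<^sup>2))"
      using a by (subst nn_integral_powr_exp) (auto simp: powr_minus field_simps add_pos_nonneg add_nonneg_pos)
    also have "\<dots> = ennreal (2 * t powr p / (t\<^sup>2 + a\<^sup>2)) * indicator {0<..} t"
      by (auto simp: indicator_def simp flip: ennreal_mult)
    finally show "ennreal (2 * t powr p / (t\<^sup>2 + a\<^sup>2)) * indicator {0<..} t = (\<integral>\<^sup>+v. F t v \<partial>lborel)" ..
  qed
  also have "\<dots> = (\<integral>\<^sup>+v. \<integral>\<^sup>+t. F t v \<partial>lborel \<partial>lborel)"
    by (rule lborel_pair.Fubini'[symmetric]) simp
  also have "\<dots> = (\<integral>\<^sup>+v. ennreal (Gamma ((1 + p) / 2)) * (ennreal (v powr ((1 - p) / 2 - 1) * exp (- a\<^sup>2 * v)) * indicator {0<..} v) \<partial>lborel)"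
  proof (rule nn_integral_cong)
    fix v :: real
    show "(\<integral>\<^sup>+t. F t v \<partial>lborel) = ennreal (Gamma ((1 + p) / 2)) * (ennreal (v powr ((1 - p) / 2 - 1) * exp (- a\<^sup>2 * v)) * indicator {0<..} v)"
    proof (cases "v > 0")
      case True
      have "(\<integral>\<^sup>+t. F t v \<partial>lborel) = (\<integral>\<^sup>+t. ennreal (exp (- a\<^sup>2 * v)) * (ennreal (2 * t powr p * exp (- v * t\<^sup>2)) * indicator {0<..} t) \<partial>lborel)"
        using True unfolding F_def 
        by (intro nn_integral_cong) (auto simp: indicator_def algebra_simps simp flip: ennreal_mult exp_add)
      also have "\<dots> = ennreal (exp (- a\<^sup>2 * v)) * (\<integral>\<^sup>+t\<in>{0<..}. ennreal (2 * t powr p * exp (- v * t\<^sup>2)) \<partial>lborel)"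
        by (intro nn_integral_cmult) auto
      also have "\<dots> = ennreal (exp (- a\<^sup>2 * v)) * ennreal (Gamma ((p + 1) / 2) * v powr (-((p + 1) / 2)))"
        using p True by (subst nn_integral_powr_gaussian) auto
      also have "-((p + 1) / 2) = (1 - p) / 2 - 1" by (simp add: field_simps)
      finally show ?thesis using True p by (simp add: add_ac mult_ac flip: ennreal_mult)
    qed (simp add: F_def)
  qed
  also have "\<dots> = ennreal (Gamma ((1 + p) / 2)) * (\<integral>\<^sup>+v\<in>{0<..}. ennreal (v powr ((1 - p) / 2 - 1) * exp (- a\<^sup>2 * v)) \<partial>lborel)"
    by (intro nn_integral_cmult) auto
  also have "\<dots> = ennreal (Gamma ((1 + p) / 2)) * ennreal (Gamma ((1 - p) / 2) * (a\<^sup>2) powr (-((1 - p) / 2)))"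
    using p a by (subst nn_integral_powr_exp) auto
  also have "(a\<^sup>2) powr (-((1 - p) / 2)) = a powr (p - 1)"
  proof -
    have "(a\<^sup>2) powr (-((1 - p) / 2)) = a powr (2 * (-((1 - p) / 2)))"
      using a by (simp add: powr_powr flip: powr_numeral)
    also have "2 * (-((1 - p) / 2)) = p - 1" by (simp add: field_simps)
    finally show ?thesis .
  qed
  finally show ?thesis using p by (simp add: mult_ac flip: ennreal_mult)
qed

subsection \<open>Partial fractions\<close>

text \<open>Logarithmic differentiation of Euler's reflection formula: the product
  \<open>Gamma z * Gamma (1 - z)\<close> and the quotient \<open>pi / sin (pi * z)\<close> are the
  same function, so their derivatives agree, and the nonzero product cancels.\<close>

lemma Digamma_reflection_complex:
  fixes z :: complex
  assumes "z \<notin> \<int>"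
  shows "Digamma (1 - z) - Digamma z = of_real pi * cot (of_real pi * z)"
proof -
  have z: "z \<notin> \<int>\<^sub>\<le>\<^sub>0" "1 - z \<notin> \<int>\<^sub>\<le>\<^sub>0"
    using assms nonpos_Ints_Int by (force, metis Ints_1 Ints_diff diff_diff_eq2 add_diff_cancel_left' nonpos_Ints_Int)
  have G: "Gamma z * Gamma (1 - z) \<noteq> 0" using z by (simp add: Gamma_eq_zero_iff)
  then have sin: "sin (of_real pi * z) \<noteq> 0" by (auto simp: Gamma_reflection_complex)
  have "((\<lambda>z. Gamma z * Gamma (1 - z)) has_field_derivative
      Gamma z * Gamma (1 - z) * (Digamma z - Digamma (1 - z))) (at z)"
    using z by (auto intro!: derivative_eq_intros simp: algebra_simps)
  moreover have "((\<lambda>z. of_real pi / sin (of_real pi * z)) has_field_derivative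
      - (Gamma z * Gamma (1 - z) * (of_real pi * cot (of_real pi * z)))) (at z)"
    using sin unfolding Gamma_reflection_complex
    by (auto intro!: derivative_eq_intros simp: cot_def power2_eq_square field_simps)
  ultimately have "Gamma z * Gamma (1 - z) * (Digamma z - Digamma (1 - z)) =
      - (Gamma z * Gamma (1 - z) * (of_real pi * cot (of_real pi * z)))"
    unfolding Gamma_reflection_complex by (rule DERIV_unique)
  then have "Gamma z * Gamma (1 - z) * (Digamma (1 - z) - Digamma z) =
      Gamma z * Gamma (1 - z) * (of_real pi * cot (of_real pi * z))"
    by (simp add: algebra_simps)
  with G show ?thesis by (simp only: mult_cancel_left) simp
qed

text \<open>The series of \<open>Digamma\<close> at \<open>1 - z\<close> and at \<open>z\<close> are
  subtracted; Euler's constant and the harmonic terms cancel.\<close>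

lemma cot_partial_fractions:
  fixes z :: complex
  assumes "z \<notin> \<int>"
  shows "(\<lambda>n. 1 / (z + of_nat (Suc n)) - 1 / (of_nat (Suc n) - z)) sums
    (of_real pi * cot (of_real pi * z) - 1 / z)"
proof -
  have nz: "z \<noteq> 0" "1 - z \<noteq> 0" using assms by auto
  have "(\<lambda>n. inverse (of_nat (Suc n)) - inverse (w + of_nat n)) sums (Digamma w + euler_mascheroni)"
    if "w \<noteq> 0" for w :: complex
    using summable_sums[OF summable_Digamma[OF that]] by (simp add: Digamma_def)
  from sums_diff[OF this[OF nz(2)] this[OF nz(1)]]
  have "(\<lambda>n. inverse (z + of_nat n) - inverse (of_nat (Suc n) - z)) sums (of_real pi * cot (of_real pi * z))"
    using Digamma_reflection_complex[OF assms] by (simp add: algebra_simps)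
  \<comment> \<open>The difference of the Digamma series pairs \<open>z + n\<close> with
    \<open>n + 1 - z\<close>. Subtracting this telescoping series shifts the first index by one and
    accounts for the isolated term \<open>1 / z\<close>.\<close>
  moreover have "(\<lambda>n. inverse (z + of_nat n) - inverse (z + of_nat (Suc n))) sums (inverse (z + of_nat 0) - 0)"
  proof (rule telescope_sums')
    show "(\<lambda>n. inverse (z + of_nat n)) \<longlonglongrightarrow> 0"
      by (intro filterlim_compose[OF tendsto_inverse_0] tendsto_add_filterlim_at_infinity[OF tendsto_const]
          tendsto_of_nat)
  qed
  ultimately show ?thesis by (auto dest: sums_diff simp: inverse_eq_divide)
qed

text \<open>The imaginary part of the cotangent expansion at \<open>z = \<i> * t / (2 * pi)\<close>,
  divided by \<open>- (2 * pi)\<close>.\<close>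

lemma coth_partial_fractions:
  fixes t :: real
  assumes t: "t > 0"
  shows "(\<lambda>n. 2 * t / (t\<^sup>2 + (2 * pi * real (Suc n))\<^sup>2)) sums (1 / 2 + 1 / (exp t - 1) - 1 / t)"
proof -
  define y where "y = t / (2 * pi)"
  have y: "y > 0" using t by (simp add: y_def)
  have "\<i> * of_real y \<notin> \<int>"
    using y by (auto elim!: Ints_cases simp: complex_eq_iff)
  from cot_partial_fractions[OF this]
  have *: "(\<lambda>n. Im (1 / (\<i> * of_real y + of_nat (Suc n)) - 1 / (of_nat (Suc n) - \<i> * of_real y))) sums
    Im (of_real pi * cot (of_real pi * (\<i> * of_real y)) - 1 / (\<i> * of_real y))" (is "?f sums ?S")
    by (rule sums_Im)
  have f: "?f n = - (2 * pi) * (2 * t / (t\<^sup>2 + (2 * pi * real (Suc n))\<^sup>2))" for n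
  proof -
    have "?f n = - 2 * y / ((real (Suc n))\<^sup>2 + y\<^sup>2)"
      by (simp add: Im_divide power2_eq_square add.commute del: of_nat_Suc)
    also have "\<dots> = - (2 * pi) * (2 * t / (t\<^sup>2 + (2 * pi * real (Suc n))\<^sup>2))"
      using t unfolding y_def by (simp add: field_simps power2_eq_square add_pos_pos del: of_nat_Suc)
    finally show ?thesis .
  qed
  have cot: "of_real pi * cot (of_real pi * (\<i> * of_real y)) = \<i> * of_real (pi * (1 + exp t) / (1 - exp t))"
  proof -
    \<comment> \<open>Since \<open>pi * y = t / 2\<close>, this \<open>u\<close> is a square root of
      \<open>exp t\<close>, and sine and cosine at \<open>\<i> * pi * y\<close> become rational in
      \<open>u\<close>.\<close>
    define u where "u = exp (pi * y)"
    have "t = pi * y + pi * y" by (simp add: y_def)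
    then have u: "exp t = u * u" "u > 0" by (simp_all only: u_def exp_add) simp
    have u2: "1 - u * u \<noteq> 0" using t u by (metis eq_iff_diff_eq_0 exp_eq_one_iff less_irrefl)
    have frac: "(b / 2) / (a / (2 * \<i>)) = \<i> * (b / a)" for a b :: complex
      by (cases "a = 0") (auto simp: field_simps)
    have e: "\<i> * (of_real pi * (\<i> * of_real y)) = of_real (- (pi * y))" "- of_real (- (pi * y)) = (of_real (pi * y) :: complex)"
      by (simp_all add: algebra_simps)
    have "sin (of_real pi * (\<i> * of_real y)) = of_real (1 / u - u) / (2 * \<i>)"
      unfolding sin_exp_eq mult_minus_right e exp_of_real by (simp add: u_def exp_minus inverse_eq_divide)
    moreover have "cos (of_real pi * (\<i> * of_real y)) = of_real (1 / u + u) / 2"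
      unfolding cos_exp_eq mult_minus_right e exp_of_real by (simp add: u_def exp_minus inverse_eq_divide)
    ultimately have "cot (of_real pi * (\<i> * of_real y)) = \<i> * of_real ((1 / u + u) / (1 / u - u))"
      using frac[of "of_real (1 / u + u)" "of_real (1 / u - u)"] by (simp only: cot_def of_real_divide)
    also have "(1 / u + u) / (1 / u - u) = (1 + exp t) / (1 - exp t)"
      using u u2 by (simp add: field_simps)
    finally show ?thesis by simp
  qed
  have S: "?S = - (2 * pi) * (1 / 2 + 1 / (exp t - 1) - 1 / t)"
  proof -
    have "exp t - 1 \<noteq> 0" "1 - exp t \<noteq> 0" using t by auto
    then have "(1 + exp t) / (1 - exp t) = - (1 + 2 / (exp t - 1))" by (simp add: field_simps)
    then have "pi * (1 + exp t) / (1 - exp t) = - pi * (1 + 2 / (exp t - 1))"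
      by (simp only: times_divide_eq_right[symmetric])
    moreover have "?S = pi * (1 + exp t) / (1 - exp t) + 2 * pi / t"
      unfolding cot using t by (simp add: y_def Im_divide power2_eq_square)
    ultimately show ?thesis by (simp add: algebra_simps)
  qed
  show ?thesis using * unfolding f S by (subst (asm) sums_mult_iff) simp_all
qed

subsection \<open>The functional equation\<close>

text \<open>The antiderivative contributes \<open>1 / t\<close> in the limit, and the sum is a
  geometric series.\<close>

lemma gap_exp:
  assumes t: "t > 0"
  shows "gap (\<lambda>x. exp (- x * t)) = ennreal (1 / t - 1 / (exp t - 1))"
proof (rule gap_eqI(1))
  let ?P = "\<lambda>x. - exp (- x * t) / t"
  show "(?P has_real_derivative exp (- x * t)) (at x)" for x
    using t by (auto intro!: derivative_eq_intros)
  show "continuous_on {0..} ?P" using t by (intro continuous_intros) auto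
  show "(\<lambda>N. ?P (real N) - ?P 0 - (\<Sum>n<N. exp (- real (Suc n) * t))) \<longlonglongrightarrow> 1 / t - 1 / (exp t - 1)"
  proof -
    have 1: "(\<lambda>N. exp (- t) ^ N) \<longlonglongrightarrow> 0" using t by (intro LIMSEQ_power_zero) auto
    have "(\<lambda>n. exp (- t) * exp (- t) ^ n) sums (exp (- t) * (1 / (1 - exp (- t))))"
      using t by (intro sums_mult geometric_sums) auto
    also have "exp (- t) * (1 / (1 - exp (- t))) = 1 / (exp t - 1)"
      using t by (simp add: exp_minus field_simps)
    also have "(\<lambda>n. exp (- t) * exp (- t) ^ n) = (\<lambda>n. exp (- real (Suc n) * t))"
      by (simp add: exp_of_nat_mult[symmetric] algebra_simps flip: exp_add)
    finally have 2: "(\<lambda>N. \<Sum>n<N. exp (- real (Suc n) * t)) \<longlonglongrightarrow> 1 / (exp t - 1)" by (simp add: sums_def)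
    have "(\<lambda>N. - (exp (- t) ^ N) / t + 1 / t - (\<Sum>n<N. exp (- real (Suc n) * t))) \<longlonglongrightarrow> - 0 / t + 1 / t - 1 / (exp t - 1)"
      using t by (intro tendsto_intros 1 2) auto
    then show ?thesis by (simp add: exp_of_nat_mult[symmetric] algebra_simps)
  qed
qed (use t in \<open>auto intro!: mult_right_mono\<close>)

text \<open>The antiderivative \<open>arctan (2 * pi * x / t) / pi\<close> tends to 1/2, which
  cancels the 1/2 in \<open>coth_partial_fractions\<close> and leaves exactly the value of
  \<open>gap_exp\<close>.\<close>

lemma gap_over_sum_squares:
  assumes t: "t > 0"
  shows "gap (\<lambda>x. 2 * t / (t\<^sup>2 + (2 * pi * x)\<^sup>2)) = ennreal (1 / t - 1 / (exp t - 1))"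
proof (rule gap_eqI(1))
  let ?P = "\<lambda>x. arctan (2 * pi * x / t) / pi"
  show "(?P has_real_derivative 2 * t / (t\<^sup>2 + (2 * pi * x)\<^sup>2)) (at x)" for x
  proof -
    have "1 + (2 * pi * x / t)\<^sup>2 = (t\<^sup>2 + (2 * pi * x)\<^sup>2) / t\<^sup>2"
      using t by (simp add: power_divide add_divide_distrib)
    then have "2 * t / (t\<^sup>2 + (2 * pi * x)\<^sup>2) = inverse (1 + (2 * pi * x / t)\<^sup>2) * (2 * pi / t) / pi"
      using t by (simp add: power2_eq_square)
    then show ?thesis using t by (auto intro!: derivative_eq_intros)
  qed
  show "continuous_on {0..} ?P" using t by (intro continuous_intros) auto
  show "2 * t / (t\<^sup>2 + (2 * pi * y)\<^sup>2) \<le> 2 * t / (t\<^sup>2 + (2 * pi * x)\<^sup>2)" if "0 < x" "x \<le> y" for x y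
    using that t by (intro divide_left_mono add_left_mono power_mono mult_left_mono mult_pos_pos add_pos_nonneg) auto
  have "filterlim (\<lambda>N. 2 * pi / t * real N) at_top sequentially"
    using t by (intro filterlim_tendsto_pos_mult_at_top[OF tendsto_const] filterlim_real_sequentially) auto
  from filterlim_compose[OF tendsto_arctan_at_top this]
  have "(\<lambda>N. arctan (2 * pi * real N / t)) \<longlonglongrightarrow> pi / 2" by simp
  then have "(\<lambda>N. arctan (2 * pi * real N / t) / pi - 0 - (\<Sum>n<N. 2 * t / (t\<^sup>2 + (2 * pi * real (Suc n))\<^sup>2)))
      \<longlonglongrightarrow> pi / 2 / pi - 0 - (1 / 2 + 1 / (exp t - 1) - 1 / t)"
    using coth_partial_fractions[OF t] unfolding sums_def by (intro tendsto_intros) auto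
  then show "(\<lambda>N. ?P (real N) - ?P 0 - (\<Sum>n<N. 2 * t / (t\<^sup>2 + (2 * pi * real (Suc n))\<^sup>2)))
      \<longlonglongrightarrow> 1 / t - 1 / (exp t - 1)" by simp
qed auto

section \<open>The functional equation on the real interval from 0 to 1\<close>

lemma zeta_reg_of_real:
  assumes "x > 0"
  shows "zeta_reg (of_real x) = of_real (Re (zeta_reg (of_real x)))"
  using cnj_zeta_reg[of "of_real x"] assms by (simp add: complex_eq_iff)

lemma zeta_reg_real_LIMSEQ:
  fixes s :: real
  assumes "s > 0"
  shows "(\<lambda>N. (s - 1) * (\<Sum>n<N. real (Suc n) powr (-s)) + real (Suc N) powr (1 - s)) \<longlonglongrightarrow> Re (zeta_reg (of_real s))"
proof -
  have "of_nat (Suc n) powr (- of_real s) = complex_of_real (real (Suc n) powr (-s))"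
    "of_nat (Suc n) powr (1 - of_real s) = complex_of_real (real (Suc n) powr (1-s))" for n
    by (simp_all flip: powr_of_real)
  from tendsto_Re[OF zeta_reg_LIMSEQ[of "of_real s", unfolded this]] assms
  show ?thesis by (simp del: of_nat_Suc)
qed

lemma gap_powr:
  fixes s :: real
  assumes s: "0 < s" "s < 1"
  shows "gap (\<lambda>x. x powr (-s)) = ennreal (Re (zeta_reg (of_real s)) / (1 - s))"
    and "Re (zeta_reg (of_real s)) / (1 - s) \<ge> 0"
proof -
  let ?P = "\<lambda>x. x powr (1 - s) / (1 - s)"
  let ?X = "\<lambda>N. ?P (real N) - ?P 0 - (\<Sum>n<N. real (Suc n) powr (-s))"
  have d: "(?P has_real_derivative x powr (-s)) (at x)" if "x > 0" for x
    using that s by (auto intro!: derivative_eq_intros)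
  have c: "continuous_on {0..} ?P" using s by (intro continuous_intros continuous_on_powr') auto
  have "(\<lambda>N. real (Suc N) powr (-s)) \<longlonglongrightarrow> 0"
    using s by (intro tendsto_neg_powr filterlim_compose[OF filterlim_real_sequentially] filterlim_Suc) auto
  \<comment> \<open>\<open>zeta_reg_real_LIMSEQ\<close> pairs \<open>N\<close> summands with the
    boundary value at \<open>N + 1\<close>, whereas \<open>gap_eqI\<close> wants
    \<open>N + 1\<close> summands there. The missing summand \<open>(N + 1) powr (-s)\<close> tends
    to 0.\<close>
  then have "(\<lambda>N. ((s - 1) * (\<Sum>n<N. real (Suc n) powr (-s)) + real (Suc N) powr (1 - s)) / (1 - s) - real (Suc N) powr (-s))
    \<longlonglongrightarrow> Re (zeta_reg (of_real s)) / (1 - s) - 0"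
    using s by (intro tendsto_intros zeta_reg_real_LIMSEQ) auto
  moreover have "((s - 1) * (\<Sum>n<N. real (Suc n) powr (-s)) + real (Suc N) powr (1 - s)) / (1 - s) - real (Suc N) powr (-s)
     = ?X (Suc N)" for N
    using s by (simp add: add_divide_distrib del: of_nat_Suc) (simp add: field_simps del: of_nat_Suc)
  ultimately have l: "?X \<longlonglongrightarrow> Re (zeta_reg (of_real s)) / (1 - s)"
    by (simp only: LIMSEQ_imp_Suc diff_zero)
  have a: "y powr (-s) \<le> x powr (-s)" if "0 < x" "x \<le> y" for x y
    using that s by (intro powr_mono2') auto
  show "gap (\<lambda>x. x powr (-s)) = ennreal (Re (zeta_reg (of_real s)) / (1 - s))"
    by (rule gap_eqI[OF _ a d c l]) auto
  show "Re (zeta_reg (of_real s)) / (1 - s) \<ge> 0"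
    by (rule gap_eqI[OF _ a d c l]) auto
qed

text \<open>Both sides evaluate the Mellin integral of \<open>1 / t - 1 / (exp t - 1)\<close>. The
  exponential kernel turns it into \<open>Gamma s\<close> times the gap of
  \<open>x powr (-s)\<close>, the rational kernel into a constant times the gap of
  \<open>x powr (s - 1)\<close>.\<close>

lemma functional_equation_real:
  fixes s :: real
  assumes s: "0 < s" "s < 1"
  shows "Gamma s * (Re (zeta_reg (of_real s)) / (1 - s)) =
    (2 * pi) powr (s - 1) * (Gamma ((1 + s) / 2) * Gamma ((1 - s) / 2)) * (Re (zeta_reg (of_real (1 - s))) / s)"
proof -
  define C where "C = (2 * pi) powr (s - 1) * (Gamma ((1 + s) / 2) * Gamma ((1 - s) / 2))"
  have C: "C \<ge> 0" using s by (simp add: C_def)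
  have "ennreal (Gamma s * (Re (zeta_reg (of_real s)) / (1 - s))) = gap (\<lambda>x. Gamma s * x powr (-s))"
    using s gap_powr[OF s] by (subst gap_cmult) (auto simp: ennreal_mult' simp del: times_divide_eq_right)
  also have "\<dots> = (\<integral>\<^sup>+t\<in>{0<..}. (ennreal (t powr (s - 1)) * gap (\<lambda>x. exp (- x * t))) \<partial>lborel)"
    using s by (intro nn_integral_gap[symmetric] nn_integral_powr_exp)
      (auto intro: mult_right_mono)
  also have "\<dots> = (\<integral>\<^sup>+t\<in>{0<..}. (ennreal (t powr (s - 1)) * gap (\<lambda>x. 2 * t / (t\<^sup>2 + (2 * pi * x)\<^sup>2))) \<partial>lborel)"
    by (intro nn_integral_cong) (auto simp: indicator_def gap_exp[unfolded mult_minus_left] gap_over_sum_squares)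
  also have "\<dots> = gap (\<lambda>x. C * x powr (s - 1))"
  proof (rule nn_integral_gap)
    fix x :: real assume x: "x > 0"
    \<comment> \<open>The numerator \<open>2 * t\<close> raises the exponent to \<open>s\<close>, so
      the Mellin integral applies with \<open>p = s\<close> and
      \<open>a = 2 * pi * x\<close>.\<close>
    have "(\<integral>\<^sup>+t\<in>{0<..}. ennreal (t powr (s - 1) * (2 * t / (t\<^sup>2 + (2 * pi * x)\<^sup>2))) \<partial>lborel)
        = (\<integral>\<^sup>+t\<in>{0<..}. ennreal (2 * t powr s / (t\<^sup>2 + (2 * pi * x)\<^sup>2)) \<partial>lborel)"
      by (intro nn_integral_cong) (auto simp: indicator_def powr_diff)
    also have "\<dots> = ennreal (C * x powr (s - 1))"
      using x s by (subst nn_integral_powr_over_sum_squares) (auto simp: C_def powr_mult mult_ac)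
    finally show "(\<integral>\<^sup>+t\<in>{0<..}. ennreal (t powr (s - 1) * (2 * t / (t\<^sup>2 + (2 * pi * x)\<^sup>2))) \<partial>lborel)
        = ennreal (C * x powr (s - 1))" .
  next
    show "2 * t / (t\<^sup>2 + (2 * pi * y)\<^sup>2) \<le> 2 * t / (t\<^sup>2 + (2 * pi * x)\<^sup>2)" if "0 < t" "0 < x" "x \<le> y" for x y t :: real
      using that by (intro divide_left_mono add_left_mono power_mono mult_left_mono mult_pos_pos add_pos_nonneg) auto
  qed (use C in auto)
  also have "\<dots> = ennreal C * gap (\<lambda>x. x powr (- (1 - s)))"
    using C by (simp add: gap_cmult)
  also have "\<dots> = ennreal (C * (Re (zeta_reg (of_real (1 - s))) / s))"
    using s C gap_powr[of "1 - s"] by (simp add: ennreal_mult' del: times_divide_eq_right)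
  \<comment> \<open>Equality in \<open>ennreal\<close> descends to the reals because both sides are
    nonnegative by \<open>gap_powr(2)\<close>.\<close>
  finally show ?thesis
    using s gap_powr(2)[of s] gap_powr(2)[of "1 - s"] C unfolding C_def[symmetric]
    by (subst (asm) ennreal_inj) (auto intro!: mult_nonneg_nonneg simp del: times_divide_eq_right)
qed

text \<open>
  The value of \<open>\<zeta>(1 - s)\<close>. Writing it with \<open>(3 - s)/2\<close> in place of \<open>(1 - s)/2\<close> cancels the pole of
  \<open>\<zeta>\<close> at \<open>s = 1\<close>.
\<close>
definition zeta_reflected :: "complex \<Rightarrow> complex" where
  "zeta_reflected s = - (1/2) * (of_real (2 * pi) powr (1 - s) * Gamma s * zeta_reg s
      * rGamma ((1 + s) / 2) * rGamma ((3 - s) / 2))"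

lemma holomorphic_zeta_reflected: "zeta_reflected holomorphic_on {s. Re s > 0}"
  unfolding zeta_reflected_def
  by (intro holomorphic_intros holomorphic_zeta_reg) (auto elim!: nonpos_Ints_cases)

text \<open>\<open>functional_equation_real\<close> solved for the value at \<open>1 - x\<close>.
  The recurrence of \<open>rGamma\<close> trades \<open>(1 - x) / 2\<close> for
  \<open>(3 - x) / 2\<close> and absorbs the factor \<open>1 / (1 - x)\<close>.\<close>

lemma zeta_reg_eq_reflected_real:
  fixes x :: real
  assumes x: "0 < x" "x < 1"
  shows "zeta_reg (1 - of_real x) = - of_real x * zeta_reflected (of_real x)"
proof -
  define a where "a = Re (zeta_reg (of_real x))"
  define b where "b = Re (zeta_reg (of_real (1 - x)))"
  have G: "Gamma ((1 + x) / 2) \<noteq> 0" "Gamma ((1 - x) / 2) \<noteq> 0"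
    using x by (auto intro!: Gamma_real_pos[THEN less_imp_neq, THEN not_sym])
  have r3: "rGamma ((3 - x) / 2) = 2 / (1 - x) * rGamma ((1 - x) / 2)"
    using rGamma_plus1[of "(1 - x) / 2"] x by (simp add: field_simps)
  have "b = x * (2 * pi) powr (1 - x) * Gamma x * a / (1 - x) * rGamma ((1 + x) / 2) * rGamma ((1 - x) / 2)"
  proof -
    have p: "(2 * pi) powr (x - 1) = inverse ((2 * pi) powr (1 - x))"
      by (simp flip: powr_minus)
    have "x * (2 * pi) powr (1 - x) * inverse (Gamma ((1 + x) / 2)) * inverse (Gamma ((1 - x) / 2))
        * (Gamma x * (a / (1 - x))) = b"
      unfolding functional_equation_real[OF x, folded a_def b_def] p
      using x G by (simp add: field_simps)
    then show ?thesis by (simp add: rGamma_inverse_Gamma mult_ac)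
  qed
  also have "\<dots> = - x * (- (1/2) * ((2 * pi) powr (1 - x) * Gamma x * a * rGamma ((1 + x) / 2) * rGamma ((3 - x) / 2)))"
    unfolding r3 using x by (simp add: field_simps)
  finally have b: "b = - x * (- (1/2) * ((2 * pi) powr (1 - x) * Gamma x * a * rGamma ((1 + x) / 2) * rGamma ((3 - x) / 2)))" .
  have "zeta_reflected (of_real x) = of_real (- (1/2) * ((2 * pi) powr (1 - x) * Gamma x * a * rGamma ((1 + x) / 2) * rGamma ((3 - x) / 2)))"
    using x zeta_reg_of_real[of x] unfolding zeta_reflected_def a_def
    by (simp add: Gamma_complex_of_real flip: powr_of_real rGamma_complex_of_real)
  moreover have "zeta_reg (1 - of_real x) = of_real b"
    using x zeta_reg_of_real[of "1 - x"] by (simp add: b_def)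
  ultimately show ?thesis by (subst (asm) b) simp
qed

text \<open>Both sides are holomorphic in the strip and agree on a real segment that accumulates at
  the interior point 1/2.\<close>

lemma zeta_reg_eq_reflected:
  assumes s: "0 < Re s" "Re s < 1"
  shows "zeta_reg (1 - s) = - s * zeta_reflected s"
proof -
  let ?S = "{s. 0 < Re s} \<inter> {s. Re s < 1}"
  have conv: "convex ?S" by (intro convex_Int convex_halfspace_Re_gt convex_halfspace_Re_lt)
  have "zeta_reg (1 - s) + s * zeta_reflected s = 0"
  proof (rule analytic_continuation[where S = ?S and U = "of_real ` {0<..<1}" and \<xi> = "1/2" and
        f = "\<lambda>s. zeta_reg (1 - s) + s * zeta_reflected s" and w = s])
    show "(\<lambda>s. zeta_reg (1 - s) + s * zeta_reflected s) holomorphic_on ?S"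
    proof (intro holomorphic_intros)
      have "zeta_reg \<circ> (\<lambda>s. 1 - s) holomorphic_on ?S"
        by (rule holomorphic_on_compose_gen[OF _ holomorphic_zeta_reg]) (auto intro!: holomorphic_intros)
      then show "(\<lambda>s. zeta_reg (1 - s)) holomorphic_on ?S" by (simp add: o_def)
      show "zeta_reflected holomorphic_on ?S"
        by (rule holomorphic_on_subset[OF holomorphic_zeta_reflected]) auto
    qed
    show "open ?S" by (intro open_Int open_halfspace_Re_gt open_halfspace_Re_lt)
    show "connected ?S" using conv by (rule convex_connected)
    show "(1 / 2 :: complex) islimpt of_real ` {0<..<1}"
    proof -
      have "(1/2 :: real) islimpt {0<..<1}" by (simp add: islimpt_greaterThanLessThan1 islimpt_greaterThanLessThan2 interior_limit_point)
      then show ?thesis using islimpt_isCont_image[of "1/2" "{0<..<1}" complex_of_real]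
        by (simp add: eventually_at_filter flip: of_real_eq_iff[where 'a = complex])
    qed
    show "zeta_reg (1 - z) + z * zeta_reflected z = 0" if "z \<in> of_real ` {0<..<1}" for z
      using that zeta_reg_eq_reflected_real by auto
  qed (use s in auto)
  then show ?thesis by (simp add: eq_neg_iff_add_eq_0)
qed

section \<open>Analytic continuation and the functional equation of zeta\<close>

lemma zeta_reg_continuation:
  "\<exists>f. f holomorphic_on - {1} \<and> (\<forall>s. Re s > 1 \<longrightarrow> f s = (\<Sum>n. 1 / of_nat (Suc n) powr s))"
proof -
  \<comment> \<open>The two pieces overlap in the open strip, where
    \<open>zeta_reg_eq_reflected\<close> at \<open>1 - s\<close> makes them agree. This supplies the
    witness for the choice in \<open>zeta\<close>.\<close>
  let ?A = "{s. Re s > 0} - {1}" and ?B = "{s. Re s < 1}"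
  let ?f = "\<lambda>s. if s \<in> ?A then zeta_reg s / (s - 1) else zeta_reflected (1 - s)"
  have "?f holomorphic_on ?A \<union> ?B"
  proof (rule holomorphic_on_If_Un)
    show "(\<lambda>s. zeta_reg s / (s - 1)) holomorphic_on ?A"
      by (intro holomorphic_intros holomorphic_on_subset[OF holomorphic_zeta_reg]) auto
    have "zeta_reflected \<circ> (\<lambda>s. 1 - s) holomorphic_on ?B"
      by (rule holomorphic_on_compose_gen[OF _ holomorphic_zeta_reflected]) (auto intro!: holomorphic_intros)
    then show "(\<lambda>s. zeta_reflected (1 - s)) holomorphic_on ?B" by (simp add: o_def)
    show "zeta_reg s / (s - 1) = zeta_reflected (1 - s)" if "s \<in> ?A" "s \<in> ?B" for s
      using that zeta_reg_eq_reflected[of "1 - s"] by (auto simp: field_simps)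
  qed (auto intro!: open_halfspace_Re_gt open_halfspace_Re_lt)
  also have "?A \<union> ?B = - {1}" by auto
  finally show ?thesis by (intro exI[of _ ?f]) (auto simp: zeta_reg_Dirichlet_series)
qed

text \<open>Whichever function the choice in \<open>zeta\<close> picks, it equals the Dirichlet
  series for \<open>Re s > 1\<close>; the identity theorem on the connected punctured half-plane
  forces the rest.\<close>

lemma zeta_eq_zeta_reg:
  assumes "Re s > 0" "s \<noteq> 1"
  shows "zeta s = zeta_reg s / (s - 1)"
proof -
  have zeta: "zeta holomorphic_on - {1}" "\<And>s. Re s > 1 \<Longrightarrow> zeta s = (\<Sum>n. 1 / of_nat (Suc n) powr s)"
    using someI_ex[OF zeta_reg_continuation] unfolding zeta_def by blast+
  show ?thesis
  proof (rule analytic_continuation_open[where f = zeta and g = "\<lambda>s. zeta_reg s / (s - 1)" and z = s])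
    show "open {s. Re s > 1}" by (rule open_halfspace_Re_gt)
    show "{s. Re s > 1} \<noteq> {}" by (auto intro: exI[of _ 2])
    show "{s. Re s > 1} \<subseteq> {s. Re s > 0} - {1}" by auto
    show "open ({s. Re s > 0} - {1 :: complex})" by (intro open_delete open_halfspace_Re_gt)
    show "connected ({s. Re s > 0} - {1 :: complex})"
      by (intro connected_open_delete convex_connected convex_halfspace_Re_gt open_halfspace_Re_gt) auto
    show "zeta holomorphic_on {s. Re s > 0} - {1}" by (rule holomorphic_on_subset[OF zeta(1)]) auto
    show "(\<lambda>s. zeta_reg s / (s - 1)) holomorphic_on {s. Re s > 0} - {1}"
      by (intro holomorphic_intros holomorphic_on_subset[OF holomorphic_zeta_reg]) auto
    show "zeta z = zeta_reg z / (z - 1)" if "z \<in> {s. Re s > 1}" for z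
      using that zeta by (simp add: zeta_reg_Dirichlet_series)
  qed (use assms in auto)
qed

lemma cnj_zeta: "Re s > 0 \<Longrightarrow> s \<noteq> 1 \<Longrightarrow> cnj (zeta s) = zeta (cnj s)"
  by (subst (1 2) zeta_eq_zeta_reg) (auto simp: cnj_zeta_reg complex_cnj_cancel_iff[of _ 1, simplified])

lemma zeta_functional_equation:
  assumes s: "0 < Re s" "Re s < 1"
  shows "zeta (1 - s) = 2 * of_real (2 * pi) powr (-s) * cos (of_real pi * s / 2) * Gamma s * zeta s"
proof -
  have ne: "s \<noteq> 0" "s \<noteq> 1" using s by auto
  \<comment> \<open>The reflection formula at \<open>(1 + s) / 2\<close> collapses the two
    \<open>rGamma\<close> factors into the cosine of the classical asymmetric form.\<close>
  have "rGamma ((1 + s) / 2) * rGamma (1 - (1 + s) / 2) = sin (of_real pi * ((1 + s) / 2)) / of_real pi"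
    by (rule rGamma_reflection_complex)
  moreover have "1 - (1 + s) / 2 = (1 - s) / 2" by (simp add: field_simps)
  moreover have "sin (of_real pi * ((1 + s) / 2)) = cos (of_real pi * s / 2)"
    by (simp add: cos_sin_eq[of "of_real pi * s / 2"] sin_cos_eq algebra_simps add_divide_distrib)
  ultimately have r: "rGamma ((1 + s) / 2) * rGamma ((1 - s) / 2) = cos (of_real pi * s / 2) / of_real pi" by simp
  have r3: "rGamma ((3 - s) / 2) = 2 / (1 - s) * rGamma ((1 - s) / 2)"
    using rGamma_plus1[of "(1 - s) / 2"] ne by (simp add: field_simps)
  have "zeta (1 - s) = zeta_reflected s"
    using zeta_reg_eq_reflected[OF s] zeta_eq_zeta_reg[of "1 - s"] s ne by (simp add: field_simps)
  also have "\<dots> = of_real (2 * pi) powr (1 - s) * Gamma s * (zeta_reg s / (s - 1)) * (rGamma ((1 + s) / 2) * rGamma ((1 - s) / 2))"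
    unfolding zeta_reflected_def r3 using ne by (simp add: divide_simps) (simp add: algebra_simps)
  also have "of_real (2 * pi) powr (1 - s) = (2 * of_real pi :: complex) * of_real (2 * pi) powr (-s)"
    by (simp add: powr_diff powr_minus field_simps)
  finally show ?thesis
    unfolding r zeta_eq_zeta_reg[OF s(1) ne(2)] by simp
qed

subsection \<open>The argument on the critical line\<close>

lemma complex_polar_of_Arg: "z = of_real (norm z) * cis (Arg z)"
  using rcis_cmod_Arg[of z] by (simp add: rcis_def)

lemma cos_quarter_pi_plus_imaginary:
  fixes y :: real
  obtains r where "r > 0" "cos (of_real (pi / 4) + \<i> * of_real y) = of_real r * cis (pi / 4 - arctan (exp (2 * y)))"
proof
  define \<alpha> where "\<alpha> = arctan (exp (2 * y))"
  have ca: "cos \<alpha> > 0"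
    using arctan_bounded[of "exp (2 * y)"] by (intro cos_gt_zero_pi) (auto simp: \<alpha>_def)
  \<comment> \<open>This is \<open>tan \<alpha> = exp (2 * y)\<close>. It makes both coordinates of
    \<open>cis (pi / 4 - \<alpha>)\<close> multiples of \<open>cos \<alpha>\<close>, and comparison
    with \<open>cosh y\<close> and \<open>sinh y\<close> gives the modulus
    \<open>1 / (2 * exp y * cos \<alpha>)\<close>.\<close>
  have sa: "sin \<alpha> = exp y * exp y * cos \<alpha>"
    using ca tan_arctan[of "exp (2 * y)"] by (simp add: \<alpha>_def tan_def field_simps flip: exp_add)
  show "1 / (2 * exp y * cos \<alpha>) > 0" using ca by simp
  show "cos (of_real (pi / 4) + \<i> * of_real y) = of_real (1 / (2 * exp y * cos \<alpha>)) * cis (pi / 4 - arctan (exp (2 * y)))"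
  proof -
    have "cos (pi / 4 - \<alpha>) = sqrt 2 / 2 * (1 + exp y * exp y) * cos \<alpha>"
      "sin (pi / 4 - \<alpha>) = sqrt 2 / 2 * (1 - exp y * exp y) * cos \<alpha>"
      by (simp_all add: cos_diff sin_diff sa cos_45 sin_45 algebra_simps)
    then have cis: "cis (pi / 4 - \<alpha>) = Complex (sqrt 2 / 2 * (1 + exp y * exp y) * cos \<alpha>)
        (sqrt 2 / 2 * (1 - exp y * exp y) * cos \<alpha>)"
      by (simp only: complex_eq_iff cis.simps complex.sel)
    show ?thesis
      unfolding \<alpha>_def[symmetric] cis complex_eq_iff using ca
      by (simp add: Re_cos Im_cos cos_45 sin_45 exp_minus) (simp add: field_simps)
  qed
qed

text \<open>Here \<gamma> may be any argument of \<open>Gamma s\<close>. The imaginary part of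
  \<open>ln_Gamma\<close> and the principal argument then give the two formulas of the
  theorem.\<close>

lemma Arg_zeta_critical_line:
  fixes \<rho> \<gamma> :: real
  defines "s \<equiv> 1/2 + \<i> * of_real \<rho>"
  assumes nz: "zeta s \<noteq> 0" and \<gamma>: "Gamma s = of_real (norm (Gamma s)) * cis \<gamma>"
  shows "\<exists>m::int. Arg (zeta s) = - 1/2 * \<gamma> + \<rho>/2 * ln (2*pi) - 9*pi/8 + 1/2 * arctan (exp (pi*\<rho>)) + of_int m * pi"
proof -
  define \<theta> where "\<theta> = Arg (zeta s)"
  define \<alpha> where "\<alpha> = arctan (exp (pi * \<rho>))"
  define N where "N = norm (zeta s)"
  have N: "N > 0" using nz by (simp add: N_def)
  have z: "zeta s = of_real N * cis \<theta>" unfolding N_def \<theta>_def by (rule complex_polar_of_Arg)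
  have s: "0 < Re s" "Re s < 1" by (simp_all add: s_def)
  have s1: "s \<noteq> 1" using s by auto
  obtain r where r: "r > 0" "cos (of_real (pi / 4) + \<i> * of_real (pi * \<rho> / 2)) = of_real r * cis (pi / 4 - \<alpha>)"
    using cos_quarter_pi_plus_imaginary[of "pi * \<rho> / 2"] unfolding \<alpha>_def by auto
  have "of_real pi * s / 2 = of_real (pi / 4) + \<i> * of_real (pi * \<rho> / 2)"
    by (simp add: s_def algebra_simps)
  then have cos: "cos (of_real pi * s / 2) = of_real r * cis (pi / 4 - \<alpha>)" by (simp only: r(2))
  have pow: "of_real (2 * pi) powr (-s) = of_real ((2 * pi) powr (-1/2)) * cis (- \<rho> * ln (2 * pi))"
  proof -
    have "of_real (2 * pi) powr (-s) = exp (- s * of_real (ln (2 * pi)))"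
      by (simp add: powr_def Ln_of_real del: of_real_mult)
    also have "- s * of_real (ln (2 * pi)) = of_real (-1/2 * ln (2 * pi)) + \<i> * of_real (- \<rho> * ln (2 * pi))"
      by (simp add: s_def algebra_simps)
    finally show ?thesis by (simp only: exp_add cis_conv_exp exp_of_real) (simp add: powr_def)
  qed
  define R where "R = 2 * (2 * pi) powr (-1/2) * r * norm (Gamma s)"
  have R: "R \<ge> 0" using r by (simp add: R_def)
  \<comment> \<open>On the critical line the reflection \<open>1 - s\<close> is conjugation, so the
    functional equation relates \<open>zeta s\<close> to its own conjugate.\<close>
  have "1 - s = cnj s" by (simp add: s_def complex_eq_iff)
  then have "cnj (zeta s) = zeta (1 - s)" using cnj_zeta[OF s(1) s1] by simp
  also have "\<dots> = 2 * of_real (2 * pi) powr (-s) * cos (of_real pi * s / 2) * Gamma s * zeta s"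
    by (rule zeta_functional_equation[OF s])
  also have "\<dots> = of_real (R * N) * (cis (- \<rho> * ln (2 * pi)) * cis (pi / 4 - \<alpha>) * cis \<gamma> * cis \<theta>)"
    unfolding cos pow z by (subst \<gamma>) (simp add: R_def)
  finally have eq: "of_real N * cis (- \<theta>) = of_real (R * N) * cis (- \<rho> * ln (2 * pi) + (pi / 4 - \<alpha>) + \<gamma> + \<theta>)"
    by (simp add: z cis_cnj cis_mult)
  have "norm (of_real N * cis (- \<theta>)) = N"
    "norm (of_real (R * N) * cis (- \<rho> * ln (2 * pi) + (pi / 4 - \<alpha>) + \<gamma> + \<theta>)) = R * N"
    using N R by (simp_all add: norm_mult)
  \<comment> \<open>Comparing moduli forces \<open>R = 1\<close>, as \<open>N\<close> is positive,
    so the phases must agree.\<close>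
  with eq have "N = R * N" by metis
  with eq N have "cis (- \<theta>) = cis (- \<rho> * ln (2 * pi) + (pi / 4 - \<alpha>) + \<gamma> + \<theta>)" by simp
  then have "cis \<theta> * cis (- \<theta>) = cis \<theta> * cis (- \<rho> * ln (2 * pi) + (pi / 4 - \<alpha>) + \<gamma> + \<theta>)" by simp
  then have "cis (\<theta> + (- \<rho> * ln (2 * pi) + (pi / 4 - \<alpha>) + \<gamma> + \<theta>)) = 1"
    unfolding cis_mult by simp
  then have "cos (\<theta> + (- \<rho> * ln (2 * pi) + (pi / 4 - \<alpha>) + \<gamma> + \<theta>)) = 1"
    by (metis cis.simps(1) one_complex.simps(1))
  then obtain n :: int where "\<theta> + (- \<rho> * ln (2 * pi) + (pi / 4 - \<alpha>) + \<gamma> + \<theta>) = of_int n * 2 * pi"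
    unfolding cos_one_2pi_int by blast
  \<comment> \<open>Halving turns \<open>pi / 4\<close> into \<open>- pi / 8\<close>; one multiple
    of \<open>pi\<close> is moved out to obtain \<open>- 9 * pi / 8\<close>, hence
    \<open>n + 1\<close>.\<close>
  then have "\<theta> = - 1/2 * \<gamma> + \<rho>/2 * ln (2*pi) - 9*pi/8 + 1/2 * \<alpha> + of_int (n + 1) * pi"
    by (simp add: field_simps)
  then show ?thesis unfolding \<theta>_def \<alpha>_def by blast
qed

text \<open>Along the line, \<open>ln_Gamma\<close> has derivative \<open>\<i>\<close> times
  \<open>Digamma\<close>, whose imaginary part is the real part of \<open>Digamma\<close>. At 0 the
  value \<open>ln_Gamma (1/2)\<close> is real, so no constant remains.\<close>

lemma integral_Re_Digamma_critical_line:
  fixes \<rho> :: real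
  assumes "\<rho> \<ge> 0"
  shows "integral {0..\<rho>} (\<lambda>t. Re (Digamma (1/2 + \<i> * of_real t))) = Im (ln_Gamma (1/2 + \<i> * of_real \<rho>))"
proof -
  let ?g = "\<lambda>t. Im (ln_Gamma (1/2 + \<i> * of_real t))"
  have "((\<lambda>t. Re (Digamma (1/2 + \<i> * of_real t))) has_integral (?g \<rho> - ?g 0)) {0..\<rho>}"
  proof (rule fundamental_theorem_of_calculus[OF assms])
    fix t :: real
    have "1/2 + \<i> * of_real t \<notin> \<real>\<^sub>\<le>\<^sub>0" by (auto simp: complex_nonpos_Reals_iff)
    then have "(ln_Gamma has_field_derivative Digamma (1/2 + \<i> * of_real t)) (at (1/2 + \<i> * of_real t))"
      by (rule has_field_derivative_ln_Gamma_complex)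
    moreover have "((\<lambda>t. 1/2 + \<i> * of_real t) has_vector_derivative \<i>) (at t within {0..\<rho>})"
      by (auto intro!: derivative_eq_intros)
    ultimately have "((\<lambda>t. ln_Gamma (1/2 + \<i> * of_real t)) has_vector_derivative (\<i> * Digamma (1/2 + \<i> * of_real t)))
       (at t within {0..\<rho>})"
      using field_vector_diff_chain_within[of "\<lambda>t. 1/2 + \<i> * of_real t" \<i> t "{0..\<rho>}" ln_Gamma]
      by (auto simp: o_def intro: has_field_derivative_at_within)
    then have "(?g has_vector_derivative Im (\<i> * Digamma (1/2 + \<i> * of_real t))) (at t within {0..\<rho>})"
      by (rule bounded_linear.has_vector_derivative[OF bounded_linear_Im])
    then show "(?g has_vector_derivative Re (Digamma (1/2 + \<i> * of_real t))) (at t within {0..\<rho>})"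
      by simp
  qed
  moreover have "?g 0 = 0" using ln_Gamma_complex_of_real[of "1/2"] by simp
  ultimately show ?thesis by (simp add: has_integral_iff)
qed

theorem mainTheorem4:
  shows "(\<exists>k :: real \<Rightarrow> int.
            (\<forall>\<rho>\<ge>0. zeta (1/2 + \<i> * of_real \<rho>) \<noteq> 0 \<longrightarrow>
               Arg (zeta (1/2 + \<i> * of_real \<rho>)) =
                 - 1/2 * integral {0..\<rho>} (\<lambda>t. Re (Digamma (1/2 + \<i> * of_real t)))
                 + \<rho>/2 * ln (2*pi) - 9*pi/8 + 1/2 * arctan (exp (pi*\<rho>)) + of_int (k \<rho>) * pi) \<and>
            (\<forall>I. is_interval I \<and> I \<subseteq> {\<rho>. \<rho> \<ge> 0 \<and> zeta (1/2 + \<i> * of_real \<rho>) \<noteq> 0} \<and>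
                 continuous_on I (\<lambda>\<rho>. Arg (zeta (1/2 + \<i> * of_real \<rho>))) \<longrightarrow>
                 k constant_on I)) \<and>
         (\<forall>\<rho>::real. \<rho> \<ge> 0 \<and> zeta (1/2 + \<i> * of_real \<rho>) \<noteq> 0 \<longrightarrow>
            (\<exists>k' :: int.
               Arg (zeta (1/2 + \<i> * of_real \<rho>)) =
                 \<rho>/2 * ln (2*pi) - 1/2 * Arg (Gamma (1/2 + \<i> * of_real \<rho>))
                 - 9*pi/8 + 1/2 * arctan (exp (pi*\<rho>)) - of_int k' * pi))"
proof (intro conjI allI impI)
  define s where "s \<rho> = 1/2 + \<i> * of_real \<rho>" for \<rho> :: real
  define D where "D = {\<rho>. \<rho> \<ge> 0 \<and> zeta (s \<rho>) \<noteq> 0}"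
  define h where "h \<rho> = - 1/2 * integral {0..\<rho>} (\<lambda>t. Re (Digamma (s t)))
      + \<rho>/2 * ln (2*pi) - 9*pi/8 + 1/2 * arctan (exp (pi*\<rho>))" for \<rho>
  have h_eq: "h \<rho> = - 1/2 * Im (ln_Gamma (s \<rho>)) + \<rho>/2 * ln (2*pi) - 9*pi/8 + 1/2 * arctan (exp (pi*\<rho>))"
    if "\<rho> \<in> D" for \<rho>
    using that integral_Re_Digamma_critical_line[of \<rho>] by (simp add: h_def D_def s_def)
  have "\<exists>m::int. Arg (zeta (s \<rho>)) = h \<rho> + of_int m * pi" if "\<rho> \<in> D" for \<rho>
  proof -
    \<comment> \<open>\<open>exp (ln_Gamma z) = Gamma z\<close> away from the poles, so
      \<open>Im (ln_Gamma (s \<rho>))\<close> is an admissible argument of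
      \<open>Gamma (s \<rho>)\<close>.\<close>
    have "s \<rho> \<notin> \<int>\<^sub>\<le>\<^sub>0" by (auto simp: s_def elim!: nonpos_Ints_cases simp: complex_eq_iff)
    then have "Gamma (s \<rho>) = exp (ln_Gamma (s \<rho>))" by (simp add: Gamma_complex_altdef)
    then have "Gamma (s \<rho>) = of_real (norm (Gamma (s \<rho>))) * cis (Im (ln_Gamma (s \<rho>)))"
      by (metis exp_eq_polar norm_exp_eq_Re)
    from Arg_zeta_critical_line[OF _ this[unfolded s_def]] that show ?thesis
      unfolding h_eq[OF that] by (simp add: s_def D_def)
  qed
  then obtain k :: "real \<Rightarrow> int" where k: "\<And>\<rho>. \<rho> \<in> D \<Longrightarrow> Arg (zeta (s \<rho>)) = h \<rho> + of_int (k \<rho>) * pi"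
    by metis
  have "k constant_on I" if I: "is_interval I" "I \<subseteq> D" "continuous_on I (\<lambda>\<rho>. Arg (zeta (s \<rho>)))" for I
  proof -
    \<comment> \<open>Continuity of \<open>h\<close> is read off its \<open>ln_Gamma\<close> form.
      Then \<open>k = (Arg - h) / pi\<close> is continuous and integer valued, hence constant on the
      connected set \<open>I\<close>.\<close>
    have "continuous_on I h"
    proof -
      have "continuous_on I (\<lambda>\<rho>. ln_Gamma (s \<rho>))"
        unfolding s_def
        by (intro continuous_on_compose2[OF continuous_on_ln_Gamma_complex[of "{z. Re z > 0}"]] continuous_intros)
          (auto simp: complex_nonpos_Reals_iff)
      then have "continuous_on I (\<lambda>\<rho>. - 1/2 * Im (ln_Gamma (s \<rho>)) + \<rho>/2 * ln (2*pi) - 9*pi/8 + 1/2 * arctan (exp (pi*\<rho>)))"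
        by (intro continuous_intros) auto
      then show ?thesis using I(2) h_eq by (simp add: subset_iff cong: continuous_on_cong)
    qed
    then have "continuous_on I (\<lambda>\<rho>. (Arg (zeta (s \<rho>)) - h \<rho>) / pi)"
      by (intro continuous_on_divide continuous_on_diff continuous_on_const I(3)) auto
    moreover have "(Arg (zeta (s \<rho>)) - h \<rho>) / pi = of_int (k \<rho>)" if "\<rho> \<in> I" for \<rho>
      using k[of \<rho>] that I by auto
    ultimately have cont: "continuous_on I (\<lambda>\<rho>. of_int (k \<rho>) :: real)"
      by (simp cong: continuous_on_cong)
    have "(\<lambda>\<rho>. of_int (k \<rho>) :: real) constant_on I"
    proof (rule continuous_discrete_range_constant[OF _ cont])
      show "connected I" using I(1) by (rule is_interval_connected)
      fix x assume "x \<in> I"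
      show "\<exists>e>0. \<forall>y. y \<in> I \<and> real_of_int (k y) \<noteq> real_of_int (k x) \<longrightarrow> e \<le> norm (real_of_int (k y) - real_of_int (k x))"
        by (intro exI[of _ 1]) (auto simp flip: of_int_diff of_int_abs)
    qed
    then have "\<forall>x\<in>I. \<forall>y\<in>I. k x = k y" unfolding constant_on_def by (metis of_int_eq_iff)
    then show ?thesis unfolding constant_on_def by metis
  qed
  with k show "\<exists>k :: real \<Rightarrow> int.
            (\<forall>\<rho>\<ge>0. zeta (1/2 + \<i> * of_real \<rho>) \<noteq> 0 \<longrightarrow>
               Arg (zeta (1/2 + \<i> * of_real \<rho>)) =
                 - 1/2 * integral {0..\<rho>} (\<lambda>t. Re (Digamma (1/2 + \<i> * of_real t)))
                 + \<rho>/2 * ln (2*pi) - 9*pi/8 + 1/2 * arctan (exp (pi*\<rho>)) + of_int (k \<rho>) * pi) \<and>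
            (\<forall>I. is_interval I \<and> I \<subseteq> {\<rho>. \<rho> \<ge> 0 \<and> zeta (1/2 + \<i> * of_real \<rho>) \<noteq> 0} \<and>
                 continuous_on I (\<lambda>\<rho>. Arg (zeta (1/2 + \<i> * of_real \<rho>))) \<longrightarrow>
                 k constant_on I)"
    unfolding D_def h_def s_def by (intro exI[of _ k]) auto
next
  fix \<rho> :: real
  assume "\<rho> \<ge> 0 \<and> zeta (1/2 + \<i> * of_real \<rho>) \<noteq> 0"
  \<comment> \<open>The same lemma, now with the principal argument of the Gamma value as \<gamma>;
    the sign convention of the second formula makes the witness \<open>- m\<close>.\<close>
  then obtain m :: int where "Arg (zeta (1/2 + \<i> * of_real \<rho>)) = - 1/2 * Arg (Gamma (1/2 + \<i> * of_real \<rho>))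
      + \<rho>/2 * ln (2*pi) - 9*pi/8 + 1/2 * arctan (exp (pi*\<rho>)) + of_int m * pi"
    using Arg_zeta_critical_line[OF _ complex_polar_of_Arg] by blast
  then show "\<exists>k' :: int. Arg (zeta (1/2 + \<i> * of_real \<rho>)) =
                 \<rho>/2 * ln (2*pi) - 1/2 * Arg (Gamma (1/2 + \<i> * of_real \<rho>))
                 - 9*pi/8 + 1/2 * arctan (exp (pi*\<rho>)) - of_int k' * pi"
    by (intro exI[of _ "- m"]) simp
qed

end
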